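(* Let $(n,k,P)$ be an ESPP instance with $P=[p_1,\dots,p_k]$ such that exactly the first $d\ge1$ parts equal $2$ (i.e. $p_1=\cdots=p_d=2$ and $p_i\ge3$ for $i>d$). Let $u=2n-s^{n,k}+1-2d$, $e=\lceil (u+1)/2\rceil$ and $m=s^{n,k}-n-1$. Then $(n,k,P)$ is not solvable if, for some $1\le i\le k-d-u$, one of the following holds: (I) $\mathrm{maxSum}\big(\sum_{i'=1}^ip_{d+u+i'},[m]\big)<i\,s^{n,k}$; (II) $\mathrm{maxSum}\big(\sum_{i'=1}^ip_{d+u+i'},[m]\big)=i\,s^{n,k}$ and $\mathrm{maxSum}\big(p_{d+e}-1,\,[m-\sum_{i'=1}^ip_{d+u+i'}]\big)<s^{n,k}/2$.
   Context: $[m]=\{1,\dots,m\}$. For a finite set $A$ of numbers and a positive integer $l\le|A|$, $\mathrm{maxSum}(l,A)$ is the sum of the $l$ largest elements of $A$. For positive integers $n,k$ with $k\mid n(n+1)/2$, $s^{n,k}=\frac{n(n+1)}{2k}$. For a non-descending composition $P=[p_1,\dots,p_k]$ of $n$, let $P_j=\sum_{i\le j}p_i$, $\mathrm{slack}_j(P)=\sum_{i=1}^{P_j}(n-i+1)-j\,s^{n,k}$ and $\mathrm{slack}(P)=\min_{1\le j<k}\mathrm{slack}_j(P)$. An ESPP instance is a triple $(n,k,P)$ with $k\mid n(n+1)/2$, $P$ a non-descending composition of $n$ into $k$ positive parts, and $\mathrm{slack}(P)\ge0$; it is solvable if $[n]$ can be partitioned into sets $A_1,\dots,A_k$ with $|A_j|=p_j$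 and each $A_j$ having element sum $s^{n,k}$.
   Formalization: Condition (II) is stated only for u ≥ 1, since for u = 0 it is false: n=69, k=23, P=[2 (17 times),4,4,4,4,5,14], i=5 satisfies (II) but is solvable; condition (I) is unrestricted. *)

theory Defs
  imports Complex_Main "HOL-Library.Disjoint_Sets"
begin

text \<open>Meant for finite \<open>A\<close> and \<open>0 < l \<le> card A\<close>.\<close>

definition maxSum :: "nat \<Rightarrow> nat set \<Rightarrow> nat" where
  "maxSum l A = sum_list (take l (rev (sorted_list_of_set A)))"

text \<open>The division is exact whenever \<open>k\<close> divides \<open>n (n + 1) / 2\<close>.\<close>

definition target :: "nat \<Rightarrow> nat \<Rightarrow> nat" where
  "target n k = n * (n + 1) div (2 * k)"

text \<open>Parts are counted from 1, while list positions are counted from 0.\<close>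

definition part :: "nat list \<Rightarrow> nat \<Rightarrow> nat" where
  "part P j = P ! (j - 1)"

definition nondescending_composition :: "nat \<Rightarrow> nat \<Rightarrow> nat list \<Rightarrow> bool" where
  "nondescending_composition n k P \<longleftrightarrow>
     length P = k \<and> (\<forall>p\<in>set P. 0 < p) \<and> sum_list P = n \<and> sorted P"

definition psum :: "nat list \<Rightarrow> nat \<Rightarrow> nat" where
  "psum P j = (\<Sum>i=1..j. part P i)"

definition slack_at :: "nat \<Rightarrow> nat \<Rightarrow> nat list \<Rightarrow> nat \<Rightarrow> int" where
  "slack_at n k P j =
     (\<Sum>i=1..psum P j. int n - int i + 1) - int j * int (target n k)"

definition slack :: "nat \<Rightarrow> nat \<Rightarrow> nat list \<Rightarrow> int" where
  "slack n k P = Min (slack_at n k P ` {1..<k})"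

text \<open>For \<open>k = 1\<close> the minimum ranges over the empty set and imposes no condition.\<close>

definition ESPP_instance :: "nat \<Rightarrow> nat \<Rightarrow> nat list \<Rightarrow> bool" where
  "ESPP_instance n k P \<longleftrightarrow>
     0 < n \<and> 0 < k \<and> k dvd n * (n + 1) div 2 \<and>
     nondescending_composition n k P \<and> (1 < k \<longrightarrow> 0 \<le> slack n k P)"

definition ESPP_solvable :: "nat \<Rightarrow> nat \<Rightarrow> nat list \<Rightarrow> bool" where
  "ESPP_solvable n k P \<longleftrightarrow>
     (\<exists>A :: nat \<Rightarrow> nat set.
        (\<Union>j\<in>{1..k}. A j) = {1..n} \<and> disjoint_family_on A {1..k} \<and>
        (\<forall>j\<in>{1..k}. card (A j) = part P j \<and> \<Sum>(A j) = target n k))"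

definition exactly_first_parts_two :: "nat \<Rightarrow> nat \<Rightarrow> nat list \<Rightarrow> bool" where
  "exactly_first_parts_two d k P \<longleftrightarrow>
     d \<le> k \<and> (\<forall>j\<in>{1..d}. part P j = 2) \<and> (\<forall>j\<in>{d+1..k}. 3 \<le> part P j)"

text \<open>The next two facts show that \<open>2 n - s + 1 - 2 d\<close> and \<open>s - n - 1\<close>, where
  \<open>s = target n k\<close>, are never negative for the instances of interest, so that
  they can be represented by natural numbers.\<close>

lemma ESPP_length_le:
  assumes "ESPP_instance n k P" "exactly_first_parts_two d k P"
  shows "2 * k \<le> n"
proof -
  have l: "length P = k" and n: "sum_list P = n"
    using assms(1) by (auto simp: ESPP_instance_def nondescending_composition_def)
  have "2 \<le> P ! j" if "j < k" for j
  proof (cases "j < d")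
    case True
    then have "Suc j \<in> {1..d}" by auto
    then show ?thesis
      using assms(2) unfolding exactly_first_parts_two_def part_def by force
  next
    case False
    then have "Suc j \<in> {d+1..k}" using that by auto
    then show ?thesis
      using assms(2) unfolding exactly_first_parts_two_def part_def by force
  qed
  then have "(\<Sum>j<k. 2) \<le> (\<Sum>j<k. P ! j)" by (intro sum_mono) auto
  also have "\<dots> = n" using l n by (metis sum_list_sum_nth atLeast0LessThan)
  finally show ?thesis by simp
qed

lemma target_exact:
  assumes "ESPP_instance n k P"
  shows "2 * k * target n k = n * (n + 1)"
proof -
  have "2 dvd n * (n + 1)" by simp
  moreover have "k dvd n * (n + 1) div 2" using assms by (simp add: ESPP_instance_def)
  ultimately have "2 * k dvd n * (n + 1)"
    by (metis dvd_mult_div_cancel mult_dvd_mono dvd_refl)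
  then show ?thesis unfolding target_def by (rule dvd_mult_div_cancel)
qed

lemma ESPP_m_nonneg:
  assumes "ESPP_instance n k P" "exactly_first_parts_two d k P"
  shows "0 \<le> int (target n k) - int n - 1"
proof -
  have "0 < n" using assms(1) by (simp add: ESPP_instance_def)
  have "n * (n + 1) \<le> n * target n k"
    using target_exact[OF assms(1)] ESPP_length_le[OF assms] by (metis mult_le_mono1)
  then have "n + 1 \<le> target n k" using \<open>0 < n\<close> by (simp only: mult_le_cancel1)
  then show ?thesis by simp
qed

lemma ESPP_u_nonneg:
  assumes "ESPP_instance n k P" "1 \<le> d" "exactly_first_parts_two d k P"
  shows "0 \<le> 2 * int n - int (target n k) + 1 - 2 * int d"
proof (cases "d < k")
  case True
  have p: "psum P d = 2 * d"
    using assms(3) by (simp add: psum_def exactly_first_parts_two_def)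
  have gauss: "(\<Sum>i=1..2*d. int n - int i + 1) = int d * (2 * int n - 2 * int d + 1)"
    by (induction d) (simp_all add: algebra_simps)
  have "0 \<le> slack n k P" using assms(1,2) True by (simp add: ESPP_instance_def)
  also have "slack n k P \<le> slack_at n k P d"
    unfolding slack_def using True assms(2) by (intro Min_le) auto
  also have "\<dots> = int d * (2 * int n - 2 * int d + 1 - int (target n k))"
    unfolding slack_at_def p gauss by (simp add: algebra_simps)
  finally show ?thesis using assms(2) by (simp add: zero_le_mult_iff)
next
  case False
  then have dk: "d = k" using assms(3) by (simp add: exactly_first_parts_two_def)
  have l: "length P = k" and n: "sum_list P = n" and "0 < n"
    using assms(1) by (auto simp: ESPP_instance_def nondescending_composition_def)
  have "P ! j = 2" if "j < k" for j
  proof -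
    have "Suc j \<in> {1..d}" using that dk by auto
    then show ?thesis
      using assms(3) unfolding exactly_first_parts_two_def part_def by force
  qed
  then have "(\<Sum>j<k. P ! j) = 2 * k" by simp
  then have n2: "n = 2 * k" using l n by (metis sum_list_sum_nth atLeast0LessThan)
  then have "n * target n k = n * (n + 1)" using target_exact[OF assms(1)] by simp
  then have "target n k = n + 1" using \<open>0 < n\<close> unfolding mult_cancel1 by simp
  then show ?thesis using dk n2 by simp
qed

end

(* In a solution with common sum s, the d two-element sets lie in {m+1..n} and are
   invariant under x |-> s - x, so the set R of the u remaining elements of {m+1..n}
   is symmetric as well. At most u of the other sets meet R, hence at least i of the
   sets with index in {d+1..d+u+i} lie inside {1..m}; comparing their total with the
   largest elements of {1..m} refutes (I). Under (II) these sets are exactly i in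
   number and fill up the top of {1..m}, so the remaining u of the sets d+1..d+u+i
   contain exactly one element of R each. By symmetry fewer than e of these elements
   exceed s/2, so some set of at most p_(d+e) elements contains only one element of R,
   of value at most s/2, and must collect the rest of its sum below the top. *)

theory Submission
  imports Defs
begin

section \<open>Exchange inequality and sums of largest elements\<close>

text \<open>The common part \<open>X \<inter> Y\<close> cancels, and \<open>c\<close> separates the
  two differences, of which \<open>X - Y\<close> is not the larger. Equal sums leave no room above
  \<open>c\<close> in \<open>Y - X\<close>, and none below it in \<open>X - Y\<close> once the
  cardinalities agree. This serves both for sums of elements and for sums of part sizes.\<close>

lemma sum_exchange:
  fixes f :: "'a \<Rightarrow> nat"
  assumes fin: "finite X" "finite Y" and card: "card X \<le> card Y"
    and low: "\<And>x. x \<in> X - Y \<Longrightarrow> f x \<le> c" and high: "\<And>y. y \<in> Y - X \<Longrightarrow> c \<le> f y"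
  shows sum_exchange_le: "sum f X \<le> sum f Y"
    and sum_exchange_eq_high: "sum f X = sum f Y \<Longrightarrow> y \<in> Y - X \<Longrightarrow> f y = c"
    and sum_exchange_eq_low: "sum f X = sum f Y \<Longrightarrow> card X = card Y \<Longrightarrow> x \<in> X - Y \<Longrightarrow> f x = c"
proof -
  have X: "sum f X = sum f (X - Y) + sum f (X \<inter> Y)"
    using fin by (metis add.commute sum.Int_Diff)
  have Y: "sum f Y = sum f (Y - X) + sum f (X \<inter> Y)"
    using fin by (metis add.commute sum.Int_Diff Int_commute)
  have cX: "card X = card (X - Y) + card (X \<inter> Y)"
    using fin by (metis add.commute card_Int_Diff)
  have cY: "card Y = card (Y - X) + card (X \<inter> Y)"
    using fin by (metis add.commute card_Int_Diff Int_commute)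
  have 1: "sum f (X - Y) \<le> card (X - Y) * c"
    using sum_bounded_above[of "X - Y" f c] low by simp
  have 2: "card (X - Y) * c \<le> card (Y - X) * c"
    using cX cY card by (intro mult_right_mono) auto
  have 3: "card (Y - X) * c \<le> sum f (Y - X)"
    using sum_bounded_below[of "Y - X" c f] high by simp
  show "sum f X \<le> sum f Y" using X Y 1 2 3 by linarith
  { assume "sum f X = sum f Y" and y: "y \<in> Y - X"
    then have "card (Y - X) * c = sum f (Y - X)" using X Y 1 2 3 by linarith
    then have "(\<Sum>y\<in>Y - X. c) = sum f (Y - X)" by simp
    then show "f y = c"
      using sum_mono_inv[of "\<lambda>_. c" "Y - X" f y] high y fin by auto }
  { assume "sum f X = sum f Y" "card X = card Y" and x: "x \<in> X - Y"
    then have "sum f (X - Y) = (\<Sum>x\<in>X - Y. c)" using X Y cX cY 1 2 3 by simp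
    then show "f x = c"
      using sum_mono_inv[of f "X - Y" "\<lambda>_. c" x] low x fin by auto }
qed

text \<open>Truncated subtraction covers \<open>l > m\<close>: both sides then sum all of
  \<open>{1..m}\<close>. So the formula applies to \<open>Q\<close> before \<open>Q \<le> m\<close>
  is known.\<close>

lemma maxSum_interval: "maxSum l {1..m} = \<Sum>{m - l<..m}"
proof -
  have "sorted_list_of_set {1..m} = [1..<Suc m]"
    by (metis atLeastLessThanSuc_atLeastAtMost sorted_list_of_set_range)
  then have "maxSum l {1..m} = sum_list [Suc (m - l)..<Suc m]"
    by (simp add: maxSum_def take_rev drop_upt rev_map del: upt_Suc)
  also have "\<dots> = \<Sum>{Suc (m - l)..<Suc m}"
    using sum_set_upt_conv_sum_list_nat[of "\<lambda>x. x" "Suc (m - l)" "Suc m"] by (simp del: upt_Suc)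
  finally show ?thesis
    by (metis atLeastLessThanSuc_atLeastAtMost atLeastSucAtMost_greaterThanAtMost)
qed

text \<open>The exchange inequality with threshold \<open>m - l\<close>. In the equality case an
  element of the top interval missing from \<open>X\<close> would have to equal
  \<open>m - l\<close>, which lies just below that interval.\<close>

lemma
  assumes X: "X \<subseteq> {1..m}" and card: "card X \<le> l"
  shows sum_le_maxSum: "\<Sum>X \<le> maxSum l {1..m}"
    and sum_eq_maxSumD: "\<Sum>X = maxSum l {1..m} \<Longrightarrow> X = {m - l<..m}"
proof -
  let ?Y = "{m - l<..m}"
  have fin: "finite X" using X finite_subset by blast
  have "card X \<le> m" using card_mono[OF _ X] by simp
  then have cards: "card X \<le> card ?Y" using card by simp
  have low: "x \<le> m - l" if "x \<in> X - ?Y" for x using that X by auto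
  have high: "m - l \<le> y" if "y \<in> ?Y - X" for y using that by auto
  note exchange = sum_exchange[of X ?Y "\<lambda>x. x" "m - l", OF fin _ cards low high]
  show "\<Sum>X \<le> maxSum l {1..m}"
    unfolding maxSum_interval using exchange(1) by simp
  assume "\<Sum>X = maxSum l {1..m}"
  then have "y = m - l" if "y \<in> ?Y - X" for y
    using exchange(2)[OF _ _ _ _ that] that unfolding maxSum_interval by simp
  then have "?Y \<subseteq> X" by fastforce
  then show "X = ?Y" using card_seteq[OF fin] cards by blast
qed

section \<open>Counting in symmetric sets and disjoint families\<close>

text \<open>The reflection \<open>x -> s - x\<close> injects the elements above s/2 into those
  below; a fixed point s/2 is in neither half.\<close>

lemma card_symmetric_high_half:
  fixes R :: "nat set"
  assumes fin: "finite R" and sym: "\<And>x. x \<in> R \<Longrightarrow> x \<le> s \<and> s - x \<in> R"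
  shows "2 * card {x \<in> R. s < 2 * x} \<le> card R"
proof -
  let ?H = "{x \<in> R. s < 2 * x}" and ?L = "{x \<in> R. 2 * x < s}"
  have "inj_on (\<lambda>x. s - x) ?H"
    using sym by (intro inj_onI) (metis (lifting) diff_diff_cancel mem_Collect_eq)
  moreover have "(\<lambda>x. s - x) ` ?H \<subseteq> ?L" using sym by fastforce
  ultimately have "card ?H \<le> card ?L" using fin by (intro card_inj_on_le) auto
  moreover have "card ?H + card ?L = card (?H \<union> ?L)"
    using fin by (intro card_Un_disjoint[symmetric]) auto
  moreover have "card (?H \<union> ?L) \<le> card R" using fin by (intro card_mono) auto
  ultimately show ?thesis by linarith
qed

lemma sum_card_Int_le:
  assumes "finite J" "finite R" "disjoint_family_on A J"
  shows "(\<Sum>j\<in>J. card (A j \<inter> R)) \<le> card R"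
proof -
  have "(\<Sum>j\<in>J. card (A j \<inter> R)) = card (\<Union>j\<in>J. A j \<inter> R)"
    using assms by (intro card_UN_disjoint[symmetric]) (auto simp: disjoint_family_on_def)
  also have "\<dots> \<le> card R" using assms by (intro card_mono) auto
  finally show ?thesis .
qed

lemma card_meeting_le:
  assumes "finite J" "finite R" "disjoint_family_on A J" "\<And>j. j \<in> J \<Longrightarrow> A j \<inter> R \<noteq> {}"
  shows "card J \<le> card R"
proof -
  have "(\<Sum>j\<in>J. 1) \<le> (\<Sum>j\<in>J. card (A j \<inter> R))"
    using assms(2,4) by (intro sum_mono) (simp add: Suc_le_eq card_gt_0_iff)
  also have "\<dots> \<le> card R" by (rule sum_card_Int_le) fact+
  finally show ?thesis by simp
qed

text \<open>Counts that are each at least 1 and total at most \<open>card J\<close> leave no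
  slack.\<close>

lemma card_Int_eq_1_if_tight:
  assumes "finite J" "finite R" "disjoint_family_on A J" "\<And>j. j \<in> J \<Longrightarrow> A j \<inter> R \<noteq> {}"
    and tight: "card R \<le> card J" and "j \<in> J"
  shows "card (A j \<inter> R) = 1"
proof -
  have ge: "1 \<le> card (A j \<inter> R)" if "j \<in> J" for j
    using assms(2,4) that by (simp add: Suc_le_eq card_gt_0_iff)
  have "(\<Sum>j\<in>J. 1) \<le> (\<Sum>j\<in>J. card (A j \<inter> R))" using ge by (intro sum_mono)
  moreover have "(\<Sum>j\<in>J. card (A j \<inter> R)) \<le> card R" by (rule sum_card_Int_le) fact+
  ultimately have "(\<Sum>j\<in>J. 1) = (\<Sum>j\<in>J. card (A j \<inter> R))" using tight by simp
  from sum_mono_inv[OF this ge \<open>j \<in> J\<close> \<open>finite J\<close>] show ?thesis by simp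
qed

text \<open>As \<open>s = n + 1 + m\<close>, two numbers with sum \<open>s\<close> that are at most
  \<open>n\<close> both exceed \<open>m\<close>. So the pairs lie in \<open>{m<..n}\<close>, and the
  reflection preserves each pair as well as this interval, whose end points \<open>m + 1\<close> and
  \<open>n\<close> sum to \<open>s\<close>.\<close>

lemma pair_complement_symmetric:
  fixes A :: "'i \<Rightarrow> nat set"
  assumes J: "finite J" "disjoint_family_on A J"
    and pairs: "\<And>j. j \<in> J \<Longrightarrow> A j \<subseteq> {1..n} \<and> card (A j) = 2 \<and> \<Sum>(A j) = s"
    and s: "s = n + 1 + m"
  defines "R \<equiv> {m<..n} - (\<Union>j\<in>J. A j)"
  shows "card R = n - m - 2 * card J"
    and "x \<in> R \<Longrightarrow> x \<le> s \<and> s - x \<in> R"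
proof -
  have pair: "\<exists>a b. A j = {a, b} \<and> a \<noteq> b \<and> a + b = s" if "j \<in> J" for j
  proof -
    obtain a b where "A j = {a, b}" "a \<noteq> b" using pairs[OF \<open>j \<in> J\<close>] card_2_iff by metis
    then show ?thesis using pairs[OF \<open>j \<in> J\<close>] by (intro exI[of _ a] exI[of _ b]) simp
  qed
  have sub: "A j \<subseteq> {m<..n}" and refl: "\<And>y. y \<in> A j \<Longrightarrow> s - y \<in> A j" if j: "j \<in> J" for j
  proof -
    obtain a b where ab: "A j = {a, b}" "a + b = s" using pair[OF j] by blast
    then have "a \<le> n" "b \<le> n" using pairs[OF j] by auto
    then show "A j \<subseteq> {m<..n}" using ab s by auto
    show "s - y \<in> A j" if "y \<in> A j" for y using that ab(2) unfolding ab(1) by auto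
  qed
  have finA: "finite (A j)" if "j \<in> J" for j using pairs[OF that] finite_subset by blast
  have "card (\<Union>j\<in>J. A j) = (\<Sum>j\<in>J. card (A j))"
    using J by (intro card_UN_disjoint) (auto simp: disjoint_family_on_def finA)
  also have "\<dots> = 2 * card J" using pairs by simp
  finally have "card (\<Union>j\<in>J. A j) = 2 * card J" .
  moreover have "(\<Union>j\<in>J. A j) \<subseteq> {m<..n}" using sub by blast
  ultimately show "card R = n - m - 2 * card J"
    unfolding R_def using J finA by (simp add: card_Diff_subset)
  assume x: "x \<in> R"
  then have "x \<le> s" "s - x \<in> {m<..n}" using s by (auto simp: R_def)
  \<comment> \<open>Reflecting once more would put \<open>x\<close> itself into
    \<open>A j\<close>.\<close>
  moreover have "s - x \<notin> A j" if "j \<in> J" for j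
    using refl[OF that, of "s - x"] x that \<open>x \<le> s\<close> by (auto simp: R_def)
  ultimately show "x \<le> s \<and> s - x \<in> R" unfolding R_def by blast
qed

theorem theorem2p11:
  fixes n k d u e m i :: nat and P :: "nat list"
  assumes "ESPP_instance n k P"
    and "1 \<le> d"
    and "exactly_first_parts_two d k P"
    and "int u = 2 * int n - int (target n k) + 1 - 2 * int d"
    and "int e = \<lceil>(real u + 1) / 2\<rceil>"
    and "int m = int (target n k) - int n - 1"
    and "1 \<le> i"
    and "int i \<le> int k - int d - int u"
    and "maxSum (\<Sum>i'=1..i. part P (d + u + i')) {1..m} < i * target n k \<or>
         (1 \<le> u \<and>
          maxSum (\<Sum>i'=1..i. part P (d + u + i')) {1..m} = i * target n k \<and>
          real (maxSum (part P (d + e) - 1) {1..m - (\<Sum>i'=1..i. part P (d + u + i'))})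
            < real (target n k) / 2)"
  shows "\<not> ESPP_solvable n k P"
proof
  assume "ESPP_solvable n k P"
  define s where "s = target n k"
  define p where "p = part P"
  obtain A where U: "(\<Union>j\<in>{1..k}. A j) = {1..n}" and disj: "disjoint_family_on A {1..k}"
    and A: "\<And>j. j \<in> {1..k} \<Longrightarrow> card (A j) = p j \<and> \<Sum>(A j) = s"
    using \<open>ESPP_solvable n k P\<close> unfolding ESPP_solvable_def s_def p_def by blast
  have An: "A j \<subseteq> {1..n}" if "j \<in> {1..k}" for j using U that by blast
  have finA: "finite (A j)" if "j \<in> {1..k}" for j using An[OF that] finite_subset by blast
  have disjD: "A j \<inter> A j' = {}" if "j \<in> {1..k}" "j' \<in> {1..k}" "j \<noteq> j'" for j j'
    using disj that by (auto simp: disjoint_family_on_def)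
  have "sorted P" "length P = k"
    using assms(1) by (auto simp: ESPP_instance_def nondescending_composition_def)
  then have mono: "p j \<le> p j'" if "j \<in> {1..k}" "j' \<in> {1..k}" "j \<le> j'" for j j'
    using that unfolding p_def part_def by (auto intro!: sorted_nth_mono)
  have p2: "p j = 2" if "j \<in> {1..d}" for j
    using assms(3) that by (auto simp: exactly_first_parts_two_def p_def)
  have p3: "3 \<le> p j" if "j \<in> {d+1..k}" for j
    using assms(3) that by (auto simp: exactly_first_parts_two_def p_def)
  have s: "s = n + 1 + m" using assms(6) by (simp add: s_def)
  \<comment> \<open>So \<open>u\<close> is what the \<open>d\<close> pairs leave of the
    \<open>n - m\<close> elements of \<open>{m<..n}\<close>.\<close>
  have u: "n - m - 2 * d = u" using assms(4,6) by linarith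
  have k: "d + u + i \<le> k" using assms(8) by linarith
  \<comment> \<open>\<open>e\<close> is the least integer above u/2, so a count of at most u/2 is
    below \<open>e\<close>.\<close>
  have "\<lceil>(real u + 1) / 2\<rceil> = int (u div 2 + 1)"
    by (rule ceiling_unique) (cases "even u"; auto elim!: evenE oddE simp: field_simps)+
  then have e: "e = u div 2 + 1" using assms(5) by linarith

  \<comment> \<open>The symmetric remainder of the two-element sets\<close>
  define R where "R = {m<..n} - (\<Union>j\<in>{1..d}. A j)"
  have disj_d: "disjoint_family_on A {1..d}"
    by (rule disjoint_family_on_mono[OF _ disj]) (use k in auto)
  have pairs: "A j \<subseteq> {1..n} \<and> card (A j) = 2 \<and> \<Sum>(A j) = s" if "j \<in> {1..d}" for j
  proof -
    have "j \<in> {1..k}" using that k by auto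
    then show ?thesis using An A p2[OF that] by simp
  qed
  have finR: "finite R" by (simp add: R_def)
  have cardR: "card R = u"
    using pair_complement_symmetric(1)[OF _ disj_d pairs s] u by (simp add: R_def)
  have symR: "x \<le> s \<and> s - x \<in> R" if "x \<in> R" for x
    using pair_complement_symmetric(2)[OF _ disj_d pairs s] that by (simp add: R_def)
  have A_sub: "A j \<subseteq> {1..m} \<union> R" if j: "j \<in> {d+1..k}" for j
  proof
    fix x assume x: "x \<in> A j"
    have "x \<notin> A j'" if "j' \<in> {1..d}" for j'
      using disjD[of j j'] that j k x by fastforce
    moreover have "x \<in> {1..n}" using An[of j] j x by auto
    ultimately show "x \<in> {1..m} \<union> R" by (auto simp: R_def)
  qed

  \<comment> \<open>Sets that avoid the remainder, and case (I)\<close>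
  define T where "T = {j \<in> {d+1..k}. A j \<inter> R \<noteq> {}}"
  \<comment> \<open>The window of \<open>u + i\<close> indices is long enough to contain
    \<open>i\<close> whose sets avoid \<open>R\<close>, and early enough for their parts to be
    bounded by its last \<open>i\<close> indices, \<open>top\<close>.\<close>
  define W where "W = {j \<in> {d+1..d+u+i}. A j \<inter> R = {}}"
  have finT: "finite T" and finW: "finite W" by (simp_all add: T_def W_def)
  have T1: "T \<subseteq> {1..k}" and W1: "W \<subseteq> {1..k}" using k by (auto simp: T_def W_def)
  have disjT: "disjoint_family_on A T" using disj T1 by (rule disjoint_family_on_mono[rotated])
  have meets: "A j \<inter> R \<noteq> {}" if "j \<in> T" for j using that by (simp add: T_def)
  have cardT: "card T \<le> u" using card_meeting_le[OF finT finR disjT meets] cardR by simp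
  have W_Un: "{d+1..d+u+i} = W \<union> (T \<inter> {d+1..d+u+i})" using k by (auto simp: W_def T_def)
  have "u + i = card {d+1..d+u+i}" by simp
  also have "\<dots> = card (W \<union> (T \<inter> {d+1..d+u+i}))" using W_Un by (rule arg_cong)
  also have "\<dots> = card W + card (T \<inter> {d+1..d+u+i})"
    using finW finT by (intro card_Un_disjoint) (auto simp: W_def T_def)
  finally have cardWT: "card W + card (T \<inter> {d+1..d+u+i}) = u + i" ..
  moreover have "card (T \<inter> {d+1..d+u+i}) \<le> card T" using finT by (intro card_mono) auto
  ultimately have cardW: "i \<le> card W" using cardT by linarith

  define top where "top = {d+u+1..d+u+i}"
  define Q where "Q = (\<Sum>i'=1..i. part P (d + u + i'))"
  have Q: "Q = sum p top"
    unfolding Q_def p_def top_def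
    by (rule sum.reindex_bij_witness[of _ "\<lambda>j. j - (d + u)" "\<lambda>j. d + u + j"]) auto
  \<comment> \<open>\<open>p (d + u)\<close> is the separating value for the exchange: window
    indices outside \<open>top\<close> are at most \<open>d + u\<close>, those in \<open>top\<close>
    are larger. By \<open>1 \<le> d\<close> it is a genuine part even if
    \<open>u = 0\<close>.\<close>
  have low: "p x \<le> p (d + u)" if "x \<in> W - top" for x
    using that k assms(2) by (intro mono) (auto simp: W_def top_def)
  have high: "p (d + u) \<le> p y" if "y \<in> top" for y
    using that k assms(2) by (intro mono) (auto simp: top_def)
  have union: "(\<Union>j\<in>I. A j) \<subseteq> {1..m}" "\<Sum>(\<Union>j\<in>I. A j) = i * s"
    "card (\<Union>j\<in>I. A j) = sum p I" "sum p I \<le> Q"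
    if I: "I \<subseteq> W" "card I = i" for I
  proof -
    have fin: "finite I" using I(1) finW finite_subset by blast
    have I1: "I \<subseteq> {1..k}" using I W1 by blast
    have dis: "\<forall>j\<in>I. \<forall>j'\<in>I. j \<noteq> j' \<longrightarrow> A j \<inter> A j' = {}" using I1 disjD by blast
    have finI: "\<forall>j\<in>I. finite (A j)" using I1 finA by blast
    show "(\<Union>j\<in>I. A j) \<subseteq> {1..m}"
    proof
      fix x assume "x \<in> (\<Union>j\<in>I. A j)"
      then obtain j where "j \<in> I" "x \<in> A j" by blast
      then show "x \<in> {1..m}" using A_sub[of j] I k by (fastforce simp: W_def)
    qed
    show "\<Sum>(\<Union>j\<in>I. A j) = i * s"
      using sum.UNION_disjoint[OF fin finI dis, of "\<lambda>x. x"] A I I1 by (simp add: subset_iff)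
    show "card (\<Union>j\<in>I. A j) = sum p I"
      using card_UN_disjoint[OF fin finI dis] A I1 by (simp add: subset_iff)
    show "sum p I \<le> Q"
      unfolding Q
    proof (rule sum_exchange_le[OF fin])
      show "p x \<le> p (d + u)" if "x \<in> I - top" for x using low[of x] that I by blast
      show "p (d + u) \<le> p y" if "y \<in> top - I" for y using high that by blast
    qed (use I in \<open>simp_all add: top_def\<close>)
  qed
  obtain I where I: "I \<subseteq> W" "card I = i" using cardW obtain_subset_with_card_n by metis
  \<comment> \<open>This excludes (I), so (II) holds, with equality here.\<close>
  have "i * s \<le> maxSum Q {1..m}"
    using sum_le_maxSum[OF union(1)[OF I], of Q] union(2-4)[OF I] by simp
  then have u1: "1 \<le> u" and max_Q: "maxSum Q {1..m} = i * s"
    and max_e: "2 * maxSum (p (d + e) - 1) {1..m - Q} < s"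
    using assms(9) by (auto simp: Q_def s_def p_def)

  \<comment> \<open>Equality case: the avoiding sets fill the top of the interval\<close>
  have fill: "(\<Union>j\<in>I. A j) = {m - Q<..m}" if "I \<subseteq> W" "card I = i" for I
    using sum_eq_maxSumD[OF union(1)[OF that], of Q] union(2-4)[OF that] max_Q by simp
  \<comment> \<open>By \<open>fill\<close>, a further \<open>j\<close> in \<open>W\<close> could
    replace a member of \<open>I\<close> without changing the union. Then \<open>A j\<close> would
    lie in a union disjoint from it, although it has at least 3 elements.\<close>
  have "W \<subseteq> I"
  proof
    fix j assume j: "j \<in> W"
    show "j \<in> I"
    proof (rule ccontr)
      assume nj: "j \<notin> I"
      obtain j1 where j1: "j1 \<in> I" using I(2) assms(7) by fastforce
      let ?I = "insert j (I - {j1})"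
      have "finite I" using I(1) finW finite_subset by blast
      then have "card ?I = i" using nj j1 I(2) assms(7) by simp
      then have "(\<Union>j\<in>?I. A j) = (\<Union>j\<in>I. A j)" using fill[of ?I] fill[OF I] I j by auto
      then have "A j \<subseteq> (\<Union>j\<in>I. A j)" by blast
      moreover have "A j \<inter> A j' = {}" if "j' \<in> I" for j'
        using disjD[of j j'] that nj j I(1) W1 by blast
      ultimately have "A j = {}" by blast
      then show False using A[of j] p3[of j] j k by (auto simp: W_def)
    qed
  qed
  then have WI: "W = I" using I by blast
  then have cW: "card W = i" using I by simp
  have fillW: "(\<Union>j\<in>W. A j) = {m - Q<..m}" using fill[OF I] WI by simp
  \<comment> \<open>With \<open>card W = i\<close> the window holds \<open>u\<close> indices from
    \<open>T\<close>. Since \<open>card T \<le> u\<close>, these are all of \<open>T\<close>, and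
    \<open>u\<close> sets share the \<open>u\<close> elements of \<open>R\<close>.\<close>
  have "card T \<le> card (T \<inter> {d+1..d+u+i})" using cardWT cW cardT by linarith
  then have "T \<inter> {d+1..d+u+i} = T" using finT by (intro card_seteq) auto
  then have T_le: "T \<subseteq> {d+1..d+u+i}" and cT: "card T = u" using cardWT cW by auto
  have single: "card (A j \<inter> R) = 1" if "j \<in> T" for j
    using card_Int_eq_1_if_tight[OF finT finR disjT meets _ that] cardR cT by simp

  \<comment> \<open>Sets whose remainder element is at most s/2\<close>
  define H where "H = {j \<in> T. A j \<inter> {x \<in> R. s < 2 * x} \<noteq> {}}"
  have "card H \<le> card {x \<in> R. s < 2 * x}"
    using finT finR disjT
    by (intro card_meeting_le) (auto simp: H_def intro: disjoint_family_on_mono)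
  then have cH: "card H < e" using card_symmetric_high_half[OF finR symR] cardR e by simp
  \<comment> \<open>The only element in \<open>R\<close> contributes at most s/2, and the numbers in
    \<open>{m - Q<..m}\<close> are taken by the sets of \<open>W\<close>, so at least s/2 must come
    from \<open>{1..m - Q}\<close>.\<close>
  have rest: "A j - R \<subseteq> {1..m - Q}" "card (A j - R) = p j - 1" "s \<le> 2 * \<Sum>(A j - R)"
    if j: "j \<in> T" "j \<notin> H" for j
  proof -
    have jk: "j \<in> {d+1..k}" "j \<in> {1..k}" using j by (auto simp: T_def)
    obtain x where x: "A j \<inter> R = {x}" using single[OF j(1)] card_1_singletonE by blast
    have "x \<in> A j" "x \<in> R" using x by blast+
    then have x2: "2 * x \<le> s" using j by (auto simp: H_def)
    have eq: "A j - R = A j - {x}" using x by blast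
    have "A j \<inter> A j' = {}" if "j' \<in> W" for j'
    proof -
      have "j \<noteq> j'" using j that by (auto simp: W_def T_def)
      then show ?thesis using disjD[OF jk(2)] that W1 by blast
    qed
    then have "A j \<inter> (\<Union>j\<in>W. A j) = {}" by blast
    then show "A j - R \<subseteq> {1..m - Q}"
      using A_sub[OF jk(1)] unfolding fillW by fastforce
    show "card (A j - R) = p j - 1"
      unfolding eq using A[OF jk(2)] \<open>x \<in> A j\<close> finA[OF jk(2)] by simp
    have "\<Sum>(A j) = x + \<Sum>(A j - {x})"
      using finA[OF jk(2)] \<open>x \<in> A j\<close> by (rule sum.remove)
    then show "s \<le> 2 * \<Sum>(A j - R)" unfolding eq using A[OF jk(2)] x2 by simp
  qed
  \<comment> \<open>(II) rules out only parts up to \<open>p (d + e)\<close>; an index in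
    \<open>T - H\<close> with such a part remains to be found.\<close>
  have big: "p (d + e) < p j" if j: "j \<in> T" "j \<notin> H" for j
  proof (rule ccontr)
    assume "\<not> p (d + e) < p j"
    then have "card (A j - R) \<le> p (d + e) - 1" using rest(2)[OF j] by simp
    from sum_le_maxSum[OF rest(1)[OF j] this] show False using rest(3)[OF j] max_e by linarith
  qed

  \<comment> \<open>Ties between parts and the final contradiction\<close>
  \<comment> \<open>For \<open>u = 0\<close> one would have \<open>e = 1\<close>;
    \<open>1 \<le> u\<close> keeps the index \<open>d + e\<close> below \<open>top\<close>.\<close>
  have "e \<le> u" using e u1 by simp
  have "card H < card T" using cH \<open>e \<le> u\<close> cT by simp
  then have "\<not> T \<subseteq> H" using card_mono[of H T] finT by (auto simp: H_def)
  then obtain j0 where j0: "j0 \<in> T" "j0 \<notin> H" by blast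
  \<comment> \<open>The \<open>j\<close> found here contradicts \<open>big\<close> if it is in
    \<open>T\<close>. Otherwise it is in \<open>W\<close> and forces the parts from
    \<open>d + e\<close> to \<open>d + u\<close> to be equal, which makes the part of
    \<open>j0\<close> small enough instead.\<close>
  have "\<not> {d+1..d+e} \<subseteq> H"
    using card_mono[of H "{d+1..d+e}"] finT cH by (auto simp: H_def)
  then obtain j where j: "j \<in> {d+1..d+e}" "j \<notin> H" by blast
  have "p j \<le> p (d + e)" using j k \<open>e \<le> u\<close> by (intro mono) auto
  then have "j \<notin> T" using big j(2) by fastforce
  moreover have "j \<in> {d+1..d+u+i}" "j \<notin> top" using j \<open>e \<le> u\<close> by (auto simp: top_def)
  ultimately have jW: "j \<in> W - top" using W_Un by blast

  \<comment> \<open>The elements left to \<open>j0\<close> show that \<open>m - Q\<close> is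
    positive, so the subtraction is not truncated and \<open>{m - Q<..m}\<close> has exactly
    \<open>Q\<close> elements.\<close>
  have "2 \<le> card (A j0 - R)" using rest(2)[OF j0] p3[of j0] j0 by (simp add: T_def)
  moreover have "card (A j0 - R) \<le> m - Q" using card_mono[OF _ rest(1)[OF j0]] by simp
  ultimately have "Q \<le> m" by linarith
  then have W_eq: "sum p W = sum p top"
    using union(3)[OF I] fillW WI Q by simp
  have ct: "card W = card top" using cW by (simp add: top_def)
  have fin_top: "finite top" by (simp add: top_def)
  have high': "p (d + u) \<le> p y" if "y \<in> top - W" for y using high that by blast
  \<comment> \<open>\<open>W\<close> and \<open>top\<close> agree in cardinality and in total size,
    so an index in only one of them has part \<open>p (d + u)\<close>. This applies to
    \<open>j\<close>, and to \<open>j0\<close> if it exceeds \<open>d + u\<close>.\<close>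
  have "p j = p (d + u)"
    by (rule sum_exchange_eq_low[OF finW fin_top eq_imp_le[OF ct] low high' W_eq ct jW])
  then have le: "p (d + u) \<le> p (d + e)" using \<open>p j \<le> p (d + e)\<close> by simp
  have "p j0 \<le> p (d + u)"
  proof (cases "j0 \<le> d + u")
    case True
    then show ?thesis using j0 k assms(2) by (intro mono) (auto simp: T_def)
  next
    case False
    moreover have "j0 \<in> {d+1..d+u+i}" using j0 T_le by blast
    ultimately have "j0 \<in> top - W" using meets[OF j0(1)] by (auto simp: top_def W_def)
    from sum_exchange_eq_high[OF finW fin_top eq_imp_le[OF ct] low high' W_eq this]
    show ?thesis by simp
  qed
  then show False using big[OF j0] le by simp
qed

end
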